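(* Let $M(z)$ be a Nevanlinna function with integral representation $$M(z)=a+bz+\int_{\mathbb{R}}\left(\frac{1}{t-z}-\frac{t}{t^2+1}\right)d\sigma(t),\qquad z\in\mathbb{C}\setminus\mathbb{R},$$ where $a\in\mathbb{R}$, $b\ge 0$, and $\sigma$ is a (positive Borel) measure on $\mathbb{R}$ with $\int_{\mathbb{R}}\frac{d\sigma(t)}{t^2+1}<\infty$. Let $\Omega\subseteq\mathbb{C}$ be a simply connected domain which is symmetric with respect to $\mathbb{R}$. Then the following statements are equivalent: (i) the restriction of $M(z)$ to $\mathbb{C}^+$ extends to a holomorphic function in $\Omega\cup\mathbb{C}^+$; (ii) the measure $\sigma$ satisfies $d\sigma(t)=\phi(t)\,dt$ for $t\in\Omega\cap\mathbb{R}$, where $\phi(z)$ is a real holomorphic function on $\Omega$.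
   Context: $\mathbb{C}^+$ and $\mathbb{C}^-$ denote the open upper and lower half-planes. A Nevanlinna function is a function $M$ holomorphic on $\mathbb{C}\setminus\mathbb{R}$, satisfying $\overline{M(z)}=M(\bar z)$ for $z\in\mathbb{C}\setminus\mathbb{R}$, and mapping $\mathbb{C}^+$ into $\mathbb{C}^+\cup\mathbb{R}$. The holomorphic extension in (i) is an extension of $M|_{\mathbb{C}^+}$ only; it is not required to agree with $M$ on $\Omega\cap\mathbb{C}^-$. A domain is a nonempty connected open set; symmetric with respect to $\mathbb{R}$ means $z\in\Omega\Leftrightarrow\bar z\in\Omega$ (so $\Omega\cap\mathbb{R}\ne\emptyset$). A holomorphic function $\phi$ on such $\Omega$ is called real if $\overline{\phi(\bar z)}=\phi(z)$ for $z\in\Omega$, i.e. $\phi$ is real-valued on $\Omega\cap\mathbb{R}$. The statement $d\sigma(t)=\phi(t)dt$, $t\in\Omega\cap\mathbb{R}$, means that the restriction of $\sigma$ to $\Omega\cap\mathbb{R}$ is absolutely continuous with density $\phi$. *)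

theory Defs
  imports "HOL-Analysis.Analysis"
begin

definition nevanlinna :: "(complex \<Rightarrow> complex) \<Rightarrow> bool" where
  "nevanlinna M \<longleftrightarrow>
     M holomorphic_on (- \<real>) \<and>
     (\<forall>z\<in>- \<real>. cnj (M z) = M (cnj z)) \<and>
     (\<forall>z. Im z > 0 \<longrightarrow> Im (M z) \<ge> 0)"

definition is_domain :: "complex set \<Rightarrow> bool" where
  "is_domain \<Omega> \<longleftrightarrow> \<Omega> \<noteq> {} \<and> open \<Omega> \<and> connected \<Omega>"

definition symmetric_wrt_reals :: "complex set \<Rightarrow> bool" where
  "symmetric_wrt_reals \<Omega> \<longleftrightarrow> (\<forall>z. z \<in> \<Omega> \<longleftrightarrow> cnj z \<in> \<Omega>)"

definition real_holomorphic_on :: "(complex \<Rightarrow> complex) \<Rightarrow> complex set \<Rightarrow> bool" where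
  "real_holomorphic_on \<phi> \<Omega> \<longleftrightarrow>
     \<phi> holomorphic_on \<Omega> \<and> (\<forall>z\<in>\<Omega>. cnj (\<phi> (cnj z)) = \<phi> z)"

text \<open>
  \<open>d\<sigma>(t) = f(t) dt\<close> on \<open>S\<close>. The nonnegativity clause is needed because \<^const>\<open>ennreal\<close>
  sends negative reals to \<open>0\<close>: without it the negative part of \<open>f\<close> would be ignored.
\<close>
definition has_density_on :: "real measure \<Rightarrow> (real \<Rightarrow> real) \<Rightarrow> real set \<Rightarrow> bool" where
  "has_density_on \<sigma> f S \<longleftrightarrow>
     f \<in> borel_measurable (restrict_space lborel S) \<and>
     (AE t in restrict_space lborel S. 0 \<le> f t) \<and>
     restrict_space \<sigma> S = density (restrict_space lborel S) (\<lambda>t. ennreal (f t))"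

end

theory Submission
  imports Defs "HOL-Complex_Analysis.Complex_Analysis"
begin

text \<open>
  Both directions rest on the jump of the Cauchy integral across the real axis: if \<open>\<sigma>\<close> has the
  density \<open>\<phi>\<close> near a real point, then the values of \<open>M\<close> just above and just below the axis differ
  by \<open>2\<pi>i \<phi>\<close>, and so \<open>\<phi> = Im M(t + i0) / \<pi>\<close>.

  From a density to a continuation.  On \<open>\<Omega> \<inter> \<complex>\<^sup>-\<close> the jump forces the continuation to be
  \<open>M + 2\<pi>i \<phi>\<close>, so it remains to continue across a real point \<open>x\<^sub>0\<close> of \<open>\<Omega>\<close>.  Split the measure at
  the ends of \<open>I = [x\<^sub>0 - r, x\<^sub>0 + r]\<close>.  The part outside \<open>I\<close> gives a function holomorphic on the disc
  around \<open>x\<^sub>0\<close> of radius \<open>r\<close> (\<open>holomorphic_nevanlinna_integral\<close>).  For the part inside, write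
  \<open>\<integral>\<^sub>I \<phi>(t)/(t-z) dt = \<integral>\<^sub>I (\<phi>(t)-\<phi>(z))/(t-z) dt + \<phi>(z) \<integral>\<^sub>I dt/(t-z)\<close>.  The first summand is holomorphic
  on the whole disc, and the second integral is an explicit logarithm whose value from below is
  that from above minus \<open>2\<pi>i\<close> (\<open>cauchy_integral_local_continuation\<close>).

  From a continuation to a density.  Given \<open>F\<close>, the function
  \<open>\<phi>(z) = (F(z) - cnj (F (cnj z))) / (2\<pi>i)\<close> is real and holomorphic, and equals \<open>Im F / \<pi>\<close> on the
  real axis.  That it is the density is Stieltjes inversion: integrate \<open>Im M(x + iy)\<close> over
  \<open>[c,d]\<close>, exchange the integrals, and let \<open>y\<close> tend to 0.  The Poisson kernel integrates to a
  difference of arctangents, which tends to \<open>\<pi>\<close> inside \<open>[c,d]\<close>, to \<open>\<pi>/2\<close> at its ends and to 0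
  outside (\<open>stieltjes_inversion_continuous_boundary\<close>).  Because \<open>F\<close> is bounded near \<open>[c,d]\<close>, the
  ends carry no mass; hence \<open>\<sigma>[c,d]\<close> is the integral of \<open>\<phi>\<close> for every \<open>[c,d]\<close> inside \<open>\<Omega>\<close>, which
  determines \<open>\<sigma>\<close> on \<open>\<Omega> \<inter> \<real>\<close> (\<open>has_density_on_of_stieltjes_inversion\<close>).
\<close>

section \<open>Cauchy integrals over a real interval\<close>

lemma integral_inverse_minus_nonreal:
  fixes z :: complex and c d :: real
  assumes "Im z \<noteq> 0" "c \<le> d"
  shows "((\<lambda>t. 1 / (complex_of_real t - z)) has_integral (Ln (of_real d - z) - Ln (of_real c - z))) {c..d}"
proof (rule fundamental_theorem_of_calculus[OF assms(2)])
  fix t assume "t \<in> {c..d}"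
  have nr: "complex_of_real t - z \<notin> \<real>\<^sub>\<le>\<^sub>0"
    using assms(1) by (auto simp: complex_nonpos_Reals_iff)
  have "((\<lambda>w. Ln (w - z)) has_field_derivative (1 / (complex_of_real t - z))) (at (of_real t))"
    using nr by (auto intro!: derivative_eq_intros simp: field_simps)
  from has_vector_derivative_real_field[OF this]
  show "((\<lambda>t. Ln (complex_of_real t - z)) has_vector_derivative 1 / (complex_of_real t - z)) (at t within {c..d})"
    by (rule has_vector_derivative_at_within)
qed

lemma segment_point_in_cball:
  fixes z :: complex and x0 r t s :: real
  assumes "z \<in> cball (of_real x0) r" "t \<in> {x0 - r..x0 + r}" "s \<in> {0..1}"
  shows "z + of_real s * (of_real t - z) \<in> cball (of_real x0) r"
proof -
  have "of_real t \<in> cball (complex_of_real x0) r"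
    using assms(2) by (auto simp: dist_norm simp flip: of_real_diff)
  from convexD[OF convex_cball assms(1) this, of "1 - s" s] assms(3)
  show ?thesis by (simp add: scaleR_conv_of_real algebra_simps)
qed

text \<open>
  The singularity of the difference quotient at \<open>t = z\<close> is removable because
  \<open>(\<phi>(t) - \<phi>(z)) / (t - z) = \<integral>\<^sub>0\<^sup>1 \<phi>'(z + s(t - z)) ds\<close>.  The right-hand side is
  smooth in all three variables, so its integral over the rectangle of the pairs \<open>(t, s)\<close> may be
  differentiated in \<open>z\<close>, including at real \<open>z\<close>.
\<close>

lemma difference_quotient_integral_holomorphic:
  fixes \<phi> :: "complex \<Rightarrow> complex" and x0 r R :: real
  assumes hol: "\<phi> holomorphic_on ball (of_real x0) R" and r: "0 < r" "r < R"
  obtains K where "K holomorphic_on ball (of_real x0) r"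
    "\<And>z. z \<in> ball (of_real x0) r \<Longrightarrow> Im z \<noteq> 0 \<Longrightarrow>
       ((\<lambda>t. (\<phi> (of_real t) - \<phi> z) / (of_real t - z)) has_integral K z) {x0 - r..x0 + r}"
proof
  define c d where "c = x0 - r" and "d = x0 + r"
  let ?B = "ball (complex_of_real x0) r"
  define p where "p z q = z + complex_of_real (snd q) * (complex_of_real (fst q) - z)"
    for z :: complex and q :: "real \<times> real"
  define K where "K z = integral (cbox (c, 0) (d, 1)) (\<lambda>q. deriv \<phi> (p z q))" for z
  have box: "cbox (c, 0) (d, 1) = {c..d} \<times> {0..(1::real)}"
    by (simp add: cbox_Pair_eq)
  have p_in: "p z q \<in> ball (of_real x0) R" if "z \<in> ?B" "q \<in> cbox (c, 0) (d, 1)" for z q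
  proof -
    have "p z q \<in> cball (of_real x0) r"
      unfolding p_def using that box
      by (intro segment_point_in_cball) (auto simp: c_def d_def mem_Times_iff)
    then show ?thesis using r by auto
  qed
  have hol1: "deriv \<phi> holomorphic_on ball (of_real x0) R"
    by (intro holomorphic_deriv hol) auto
  have hol2: "deriv (deriv \<phi>) holomorphic_on ball (of_real x0) R"
    by (intro holomorphic_deriv hol1) auto
  have cont: "continuous_on (cbox (c, 0) (d, 1)) (\<lambda>q. deriv \<phi> (p z q))" if "z \<in> ?B" for z
    by (rule continuous_on_compose2[OF holomorphic_on_imp_continuous_on[OF hol1]])
       (use p_in that in \<open>auto simp: p_def[abs_def] intro!: continuous_intros\<close>)
  show "K holomorphic_on ?B"
    unfolding K_def
  proof (rule leibniz_rule_holomorphic)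
    fix z q assume z: "z \<in> ?B" and q: "q \<in> cbox (c, 0) (d, 1::real)"
    have "(deriv \<phi> has_field_derivative deriv (deriv \<phi>) (p z q)) (at (p z q))"
      using hol1 p_in[OF z q] by (auto intro: holomorphic_derivI)
    moreover have "((\<lambda>z. p z q) has_field_derivative (1 - of_real (snd q))) (at z within ?B)"
      unfolding p_def by (auto intro!: derivative_eq_intros)
    ultimately show "((\<lambda>z. deriv \<phi> (p z q)) has_field_derivative
        (deriv (deriv \<phi>) (p z q) * (1 - of_real (snd q)))) (at z within ?B)"
      by (rule DERIV_chain2)
  next
    show "(\<lambda>q. deriv \<phi> (p z q)) integrable_on cbox (c, 0) (d, 1)" if "z \<in> ?B" for z
      using cont[OF that] by (rule integrable_continuous)
  next
    have "continuous_on (?B \<times> cbox (c, 0) (d, 1)) (\<lambda>x. deriv (deriv \<phi>) (p (fst x) (snd x)))"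
      by (rule continuous_on_compose2[OF holomorphic_on_imp_continuous_on[OF hol2]])
         (use p_in in \<open>auto simp: p_def[abs_def] intro!: continuous_intros\<close>)
    then show "continuous_on (?B \<times> cbox (c, 0) (d, 1))
        (\<lambda>(z, q). deriv (deriv \<phi>) (p z q) * (1 - of_real (snd q)))"
      by (auto simp: case_prod_unfold intro!: continuous_intros)
  qed auto
  fix z assume z: "z \<in> ?B" and im: "Im z \<noteq> 0"
  have inner: "integral {0..1} (\<lambda>s. deriv \<phi> (p z (t, s))) = (\<phi> (of_real t) - \<phi> z) / (of_real t - z)"
    if t: "t \<in> {c..d}" for t
  proof -
    have nz: "of_real t - z \<noteq> 0" using im by (auto simp: complex_eq_iff)
    have "((\<lambda>s. deriv \<phi> (p z (t, s)) * (of_real t - z)) has_integral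
            \<phi> (p z (t, 1)) - \<phi> (p z (t, 0))) {0..1}"
    proof (rule fundamental_theorem_of_calculus)
      fix s :: real assume s: "s \<in> {0..1}"
      have q: "(t, s) \<in> cbox (c, 0) (d, 1)" using s t box by auto
      have "(\<phi> has_field_derivative deriv \<phi> (p z (t, s))) (at (p z (t, s)))"
        using hol p_in[OF z q] by (auto intro: holomorphic_derivI)
      then have "((\<lambda>w. \<phi> (z + w * (of_real t - z))) has_field_derivative
          deriv \<phi> (p z (t, s)) * (of_real t - z)) (at (of_real s))"
        by (intro DERIV_chain2[where f = \<phi>]) (auto simp: p_def intro!: derivative_eq_intros)
      from has_vector_derivative_real_field[OF this]
      show "((\<lambda>s. \<phi> (p z (t, s))) has_vector_derivative deriv \<phi> (p z (t, s)) * (of_real t - z))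
          (at s within {0..1})"
        by (auto simp: p_def intro: has_vector_derivative_at_within)
    qed auto
    from has_integral_divide[OF this, of "of_real t - z"] nz
    show ?thesis by (auto simp: p_def intro!: integral_unique)
  qed
  have "K z = integral {c..d} (\<lambda>t. integral {0..1} (\<lambda>s. deriv \<phi> (p z (t, s))))"
    unfolding K_def using integral_prod_continuous[OF cont[OF z]] by simp
  also have "\<dots> = integral {c..d} (\<lambda>t. (\<phi> (of_real t) - \<phi> z) / (of_real t - z))"
    using inner by (intro integral_cong) auto
  finally have "K z = \<dots>" .
  moreover have "(\<lambda>t. (\<phi> (of_real t) - \<phi> z) / (of_real t - z)) integrable_on {c..d}"
  proof (intro integrable_continuous_real continuous_intros)
    show "continuous_on {c..d} (\<lambda>t. \<phi> (of_real t))"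
      by (rule continuous_on_compose2[OF holomorphic_on_imp_continuous_on[OF hol]])
         (use r in \<open>auto simp: c_def d_def dist_norm intro!: continuous_intros simp flip: of_real_diff\<close>)
    show "\<forall>t\<in>{c..d}. complex_of_real t - z \<noteq> 0" using im by (auto simp: complex_eq_iff)
  qed
  ultimately show "((\<lambda>t. (\<phi> (of_real t) - \<phi> z) / (of_real t - z)) has_integral K z) {x0 - r..x0 + r}"
    unfolding c_def d_def by (simp add: has_integral_integral)
qed

text \<open>
  Continuation of the Cauchy integral through its interval of integration, with the
  Plemelj jump \<open>2\<pi>i \<phi>\<close>.  The jump comes from \<open>\<integral> dt/(t-z) = Ln (d-z) - Ln (c-z)\<close>: for \<open>z\<close> in the disc
  over \<open>[c,d]\<close> the number \<open>c - z\<close> has negative real part, so that its principal logarithm jumps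
  when \<open>z\<close> crosses the real axis, whereas \<open>Ln (z - c)\<close> is holomorphic on the whole disc and differs
  from it by \<open>\<plusminus>\<pi>i\<close>.
\<close>

lemma cauchy_integral_local_continuation:
  fixes \<phi> :: "complex \<Rightarrow> complex" and x0 r R :: real
  assumes hol: "\<phi> holomorphic_on ball (of_real x0) R" and r: "0 < r" "r < R"
  obtains H where "H holomorphic_on ball (of_real x0) r"
    "\<And>z. z \<in> ball (of_real x0) r \<Longrightarrow> Im z > 0 \<Longrightarrow>
       ((\<lambda>t. \<phi> (of_real t) / (of_real t - z)) has_integral H z) {x0 - r..x0 + r}"
    "\<And>z. z \<in> ball (of_real x0) r \<Longrightarrow> Im z < 0 \<Longrightarrow>
       ((\<lambda>t. \<phi> (of_real t) / (of_real t - z)) has_integral (H z - 2 * of_real pi * \<i> * \<phi> z)) {x0 - r..x0 + r}"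
proof -
  let ?B = "ball (complex_of_real x0) r"
  obtain K where K: "K holomorphic_on ?B"
    "\<And>z. z \<in> ?B \<Longrightarrow> Im z \<noteq> 0 \<Longrightarrow>
       ((\<lambda>t. (\<phi> (of_real t) - \<phi> z) / (of_real t - z)) has_integral K z) {x0 - r..x0 + r}"
    using difference_quotient_integral_holomorphic[OF hol r] by blast
  define L where "L z = Ln (of_real (x0 + r) - z) - Ln (z - of_real (x0 - r))" for z
  define H where "H z = K z + \<phi> z * (L z + of_real pi * \<i>)" for z
  have Re_bound: "\<bar>Re z - x0\<bar> < r" if "z \<in> ?B" for z
    using that abs_Re_le_cmod[of "of_real x0 - z"] by (auto simp: dist_norm)
  have "L holomorphic_on ?B"
    unfolding L_def
    using Re_bound by (intro holomorphic_intros) (force simp: complex_nonpos_Reals_iff)+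
  moreover have "\<phi> holomorphic_on ?B"
    using hol r by (auto elim: holomorphic_on_subset)
  ultimately have "H holomorphic_on ?B"
    unfolding H_def by (intro holomorphic_intros K)
  moreover have split: "((\<lambda>t. \<phi> (of_real t) / (of_real t - z)) has_integral
      K z + \<phi> z * (Ln (of_real (x0 + r) - z) - Ln (of_real (x0 - r) - z))) {x0 - r..x0 + r}"
    if "z \<in> ?B" "Im z \<noteq> 0" for z
  proof -
    have "((\<lambda>t. (\<phi> (of_real t) - \<phi> z) / (of_real t - z) + \<phi> z * (1 / (of_real t - z))) has_integral
      K z + \<phi> z * (Ln (of_real (x0 + r) - z) - Ln (of_real (x0 - r) - z))) {x0 - r..x0 + r}"
      using that r by (intro has_integral_add has_integral_mult_right K integral_inverse_minus_nonreal) auto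
    then show ?thesis by (simp add: diff_divide_distrib)
  qed
  have Ln_left: "Ln (of_real (x0 - r) - z) = Ln (z - of_real (x0 - r)) - sgn (Im z) * of_real pi * \<i>"
    if "Im z \<noteq> 0" for z
    using that Ln_minus[of "z - of_real (x0 - r)"] by (auto simp: complex_eq_iff sgn_if)
  have "((\<lambda>t. \<phi> (of_real t) / (of_real t - z)) has_integral H z) {x0 - r..x0 + r}"
    if "z \<in> ?B" "Im z > 0" for z
  proof -
    have "H z = K z + \<phi> z * (Ln (of_real (x0 + r) - z) - Ln (of_real (x0 - r) - z))"
      using that Ln_left[of z] unfolding H_def L_def by simp
    then show ?thesis using split[of z] that by simp
  qed
  moreover have "((\<lambda>t. \<phi> (of_real t) / (of_real t - z)) has_integral (H z - 2 * of_real pi * \<i> * \<phi> z)) {x0 - r..x0 + r}"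
    if "z \<in> ?B" "Im z < 0" for z
  proof -
    have "H z - 2 * of_real pi * \<i> * \<phi> z
        = K z + \<phi> z * (Ln (of_real (x0 + r) - z) - Ln (of_real (x0 - r) - z))"
      using that Ln_left[of z] unfolding H_def L_def by (simp add: ring_distribs)
    then show ?thesis using split[of z] that by simp
  qed
  ultimately show ?thesis using that by blast
qed

section \<open>The integral of the Nevanlinna kernel\<close>

definition nevanlinna_kernel :: "complex \<Rightarrow> real \<Rightarrow> complex" where
  "nevanlinna_kernel z t = 1 / (complex_of_real t - z) - complex_of_real (t / (t\<^sup>2 + 1))"

lemma measurable_nevanlinna_kernel [measurable]: "nevanlinna_kernel z \<in> borel_measurable borel"
  unfolding nevanlinna_kernel_def by measurable

text \<open>
  Away from its pole the kernel decays like \<open>1/(t\<^sup>2 + 1)\<close>, uniformly for bounded \<open>z\<close>.  This is the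
  comparison behind every dominated convergence below.
\<close>

lemma one_plus_abs_le_distance:
  fixes z :: complex and t :: real
  assumes "cmod z \<le> R" "0 < \<rho>" "\<rho> \<le> cmod (of_real t - z)"
  shows "1 + \<bar>t\<bar> \<le> (1 + (1 + R) / \<rho>) * cmod (of_real t - z)"
proof -
  have "\<bar>t\<bar> \<le> cmod (of_real t - z) + cmod z"
    using norm_triangle_ineq[of "of_real t - z" z] by simp
  moreover have "0 \<le> 1 + R" using assms(1) norm_ge_zero[of z] by linarith
  then have "1 + R \<le> (1 + R) / \<rho> * cmod (of_real t - z)"
    using mult_left_mono[OF assms(3), of "(1 + R) / \<rho>"] assms(2) by simp
  ultimately show ?thesis using assms(1) by (simp add: ring_distribs)
qed

text \<open>
  The subtracted term \<open>t/(t\<^sup>2 + 1)\<close> turns the kernel into \<open>(1 + tz) / ((t - z)(t\<^sup>2 + 1))\<close>, whose first factor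
  \<open>(1 + tz)/(t - z)\<close> stays bounded.
\<close>

lemma norm_nevanlinna_kernel_le:
  fixes z :: complex and t :: real
  assumes z: "cmod z \<le> R" and \<rho>: "0 < \<rho>" "\<rho> \<le> cmod (of_real t - z)"
  shows "cmod (nevanlinna_kernel z t) \<le> (1 + R) * (1 + (1 + R) / \<rho>) * (1 / (t\<^sup>2 + 1))"
proof -
  let ?C = "1 + (1 + R) / \<rho>" and ?d = "cmod (of_real t - z)"
  have R: "0 \<le> R" using z norm_ge_zero[of z] by linarith
  have d: "0 < ?d" using \<rho> by linarith
  have "complex_of_real (t\<^sup>2 + 1) \<noteq> 0"
    unfolding of_real_eq_0_iff by (metis add_pos_nonneg less_irrefl zero_le_power2 zero_less_one add.commute)
  then have "nevanlinna_kernel z t = (1 + of_real t * z) / ((of_real t - z) * of_real (t\<^sup>2 + 1))"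
    using d unfolding nevanlinna_kernel_def by (auto simp: field_simps power2_eq_square)
  then have "cmod (nevanlinna_kernel z t) = cmod (1 + of_real t * z) / (?d * (t\<^sup>2 + 1))"
    by (simp add: norm_divide norm_mult del: of_real_add of_real_power)
  also have "\<dots> \<le> ((1 + R) * (?C * ?d)) / (?d * (t\<^sup>2 + 1))"
  proof (intro divide_right_mono)
    have "cmod (1 + of_real t * z) \<le> 1 + \<bar>t\<bar> * R"
      using norm_triangle_ineq[of 1 "of_real t * z"] mult_left_mono[OF z, of "\<bar>t\<bar>"]
      by (simp add: norm_mult)
    also have "\<dots> \<le> (1 + R) * (1 + \<bar>t\<bar>)" using R by (simp add: ring_distribs)
    also have "\<dots> \<le> (1 + R) * (?C * ?d)"
      using R by (intro mult_left_mono one_plus_abs_le_distance assms) auto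
    finally show "cmod (1 + of_real t * z) \<le> (1 + R) * (?C * ?d)" .
  qed auto
  also have "\<dots> = (1 + R) * ?C * (1 / (t\<^sup>2 + 1))" using d by simp
  finally show ?thesis .
qed

locale poisson_finite_measure =
  fixes \<sigma> :: "real measure"
  assumes sets_eq [measurable_cong, simp]: "sets \<sigma> = sets borel"
    and poisson_finite: "(\<integral>\<^sup>+ t. ennreal (1 / (t\<^sup>2 + 1)) \<partial>\<sigma>) < \<infinity>"
begin

lemma integrable_poisson_weight: "integrable \<sigma> (\<lambda>t. 1 / (t\<^sup>2 + 1))"
  using poisson_finite by (intro integrableI_nonneg) auto

lemma integrable_nevanlinna_kernel_on:
  assumes S: "S \<in> sets borel" and \<rho>: "0 < \<rho>" "\<And>t. t \<in> S \<Longrightarrow> \<rho> \<le> cmod (of_real t - z)"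
  shows "set_integrable \<sigma> S (nevanlinna_kernel z)"
  unfolding set_integrable_def
proof (rule Bochner_Integration.integrable_bound)
  let ?C = "(1 + cmod z) * (1 + (1 + cmod z) / \<rho>)"
  show "integrable \<sigma> (\<lambda>t. ?C * (1 / (t\<^sup>2 + 1)))"
    by (intro integrable_mult_right integrable_poisson_weight)
  show "(\<lambda>t. indicator S t *\<^sub>R nevanlinna_kernel z t) \<in> borel_measurable \<sigma>"
    using S by measurable
  have "norm (indicator S t *\<^sub>R nevanlinna_kernel z t) \<le> norm (?C * (1 / (t\<^sup>2 + 1)))" for t
    using norm_nevanlinna_kernel_le[OF order_refl \<rho>(1) \<rho>(2), of t] \<rho>(1)
    by (cases "t \<in> S") (auto intro: order_trans[OF _ abs_ge_self])
  then show "AE t in \<sigma>. norm (indicator S t *\<^sub>R nevanlinna_kernel z t) \<le> norm (?C * (1 / (t\<^sup>2 + 1)))"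
    by simp
qed

lemma integrable_nevanlinna_kernel:
  assumes "Im z \<noteq> 0"
  shows "integrable \<sigma> (nevanlinna_kernel z)"
proof -
  have "set_integrable \<sigma> UNIV (nevanlinna_kernel z)"
    using assms abs_Im_le_cmod[of "of_real _ - z"]
    by (intro integrable_nevanlinna_kernel_on[of _ "\<bar>Im z\<bar>"]) auto
  then show ?thesis by (simp add: set_integrable_def)
qed

text \<open>
  The difference of two kernels is \<open>(z - w) / ((t - z)(t - w))\<close>, so the difference quotient at \<open>w\<close> is an
  integral that converges by dominated convergence as \<open>z\<close> tends to \<open>w\<close>.
\<close>

lemma holomorphic_nevanlinna_integral:
  assumes S: "S \<in> sets borel" and U: "open U" "\<And>t. t \<in> S \<Longrightarrow> complex_of_real t \<notin> U"
  shows "(\<lambda>z. LINT t:S|\<sigma>. nevanlinna_kernel z t) holomorphic_on U"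
proof -
  define f where "f z = (LINT t:S|\<sigma>. nevanlinna_kernel z t)" for z
  have "\<exists>D. (f has_field_derivative D) (at w)" if w: "w \<in> U" for w
  proof -
    obtain e where e: "0 < e" "ball w e \<subseteq> U" using U(1) w openE by blast
    define \<delta> where "\<delta> = e / 2"
    have \<delta>: "0 < \<delta>" using e by (simp add: \<delta>_def)
    have far: "\<delta> \<le> cmod (of_real t - z)" if "z \<in> ball w \<delta>" "t \<in> S" for z t
    proof (rule ccontr)
      assume "\<not> ?thesis"
      then have "dist w (of_real t) < e"
        using dist_triangle[of w "of_real t" z] that(1)
        by (simp add: \<delta>_def dist_norm norm_minus_commute)
      with e(2) U(2)[OF that(2)] show False by auto
    qed
    define g where "g z t = indicator S t *\<^sub>R (1 / ((complex_of_real t - z) * (of_real t - w)))" for z t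
    have quotient: "(f z - f w) / (z - w) = (\<integral>t. g z t \<partial>\<sigma>)" if z: "z \<in> ball w \<delta> - {w}" for z
    proof -
      have "f z - f w = (\<integral>t. indicator S t *\<^sub>R nevanlinna_kernel z t - indicator S t *\<^sub>R nevanlinna_kernel w t \<partial>\<sigma>)"
        unfolding f_def set_lebesgue_integral_def
        using integrable_nevanlinna_kernel_on[OF S \<delta>] far z \<delta>
        by (intro Bochner_Integration.integral_diff[symmetric]) (auto simp: set_integrable_def)
      also have "\<dots> = (\<integral>t. (z - w) * g z t \<partial>\<sigma>)"
      proof (rule Bochner_Integration.integral_cong)
        fix t
        show "indicator S t *\<^sub>R nevanlinna_kernel z t - indicator S t *\<^sub>R nevanlinna_kernel w t = (z - w) * g z t"
        proof (cases "t \<in> S")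
          case True
          then have "of_real t - z \<noteq> 0" "of_real t - w \<noteq> 0"
            using far[of z t] far[of w t] z \<delta> by auto
          then have "1 / (of_real t - z) - 1 / (of_real t - w) = (z - w) * (1 / ((of_real t - z) * (of_real t - w)))"
            by (simp add: divide_simps)
          with True show ?thesis by (simp add: nevanlinna_kernel_def g_def)
        qed (simp add: g_def)
      qed simp
      finally show ?thesis using z by simp
    qed
    \<comment> \<open>Restricting the limit to the ball makes the bound valid for every term of the sequence.\<close>
    have "((\<lambda>z. (f z - f w) / (z - w)) \<longlongrightarrow> (\<integral>t. g w t \<partial>\<sigma>)) (at w within ball w \<delta>)"
      unfolding tendsto_at_iff_sequentially comp_def
    proof (intro allI impI)
      fix X :: "nat \<Rightarrow> complex"
      assume X: "\<forall>i. X i \<in> ball w \<delta> - {w}" and lim: "X \<longlonglongrightarrow> w"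
      let ?C = "1 + (1 + (cmod w + \<delta>)) / \<delta>"
      have "(\<lambda>i. \<integral>t. g (X i) t \<partial>\<sigma>) \<longlonglongrightarrow> (\<integral>t. g w t \<partial>\<sigma>)"
      proof (rule integral_dominated_convergence[where w = "\<lambda>t. ?C\<^sup>2 * (1 / (t\<^sup>2 + 1))"])
        show "integrable \<sigma> (\<lambda>t. ?C\<^sup>2 * (1 / (t\<^sup>2 + 1)))"
          by (intro integrable_mult_right integrable_poisson_weight)
        show "(\<lambda>t. g w t) \<in> borel_measurable \<sigma>" "\<And>i. (\<lambda>t. g (X i) t) \<in> borel_measurable \<sigma>"
          unfolding g_def using S by measurable
        have "(\<lambda>i. g (X i) t) \<longlonglongrightarrow> g w t" for t
          unfolding g_def using far[of w t] \<delta>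
          by (cases "t \<in> S") (auto intro!: tendsto_intros lim)
        then show "AE t in \<sigma>. (\<lambda>i. g (X i) t) \<longlonglongrightarrow> g w t" by simp
        have "norm (g (X i) t) \<le> ?C\<^sup>2 * (1 / (t\<^sup>2 + 1))" for i t
        proof (cases "t \<in> S")
          case True
          have z: "X i \<in> ball w \<delta>" using X by auto
          have cm: "cmod (X i) \<le> cmod w + \<delta>"
            using z norm_triangle_ineq[of "X i - w" w] by (simp add: dist_norm norm_minus_commute)
          have "(1 + \<bar>t\<bar>) * (1 + \<bar>t\<bar>) \<le> (?C * cmod (of_real t - X i)) * (?C * cmod (of_real t - w))"
            using \<delta> far[OF z True] far[of w, OF _ True] cm
            by (intro mult_mono one_plus_abs_le_distance) auto
          moreover have "t\<^sup>2 + 1 \<le> (1 + \<bar>t\<bar>) * (1 + \<bar>t\<bar>)"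
            by (simp add: ring_distribs power2_eq_square)
          ultimately have le: "t\<^sup>2 + 1 \<le> ?C\<^sup>2 * (cmod (of_real t - X i) * cmod (of_real t - w))"
            by (simp add: power2_eq_square mult_ac)
          have "0 < cmod (of_real t - X i)" "0 < cmod (of_real t - w)"
            using \<delta> far[OF z True] far[of w, OF _ True] less_le_trans[OF \<delta>] by (simp_all only: centre_in_ball)
          then have "0 < cmod (of_real t - X i) * cmod (of_real t - w)" by (rule mult_pos_pos)
          moreover have "0 < t\<^sup>2 + 1" by (simp add: add_nonneg_pos)
          ultimately have "1 / (cmod (of_real t - X i) * cmod (of_real t - w)) \<le> ?C\<^sup>2 * (1 / (t\<^sup>2 + 1))"
            using le by (simp add: field_simps)
          then show ?thesis using True by (simp add: g_def norm_divide norm_mult)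
        qed (simp add: g_def)
        then show "AE t in \<sigma>. norm (g (X i) t) \<le> ?C\<^sup>2 * (1 / (t\<^sup>2 + 1))" for i by simp
      qed
      then show "(\<lambda>n. (f (X n) - f w) / (X n - w)) \<longlonglongrightarrow> (\<integral>t. g w t \<partial>\<sigma>)"
        using X quotient by simp
    qed
    moreover have "at w within ball w \<delta> = at w" using \<delta> by (intro at_within_open) auto
    ultimately show ?thesis by (auto simp: has_field_derivative_iff)
  qed
  then show ?thesis
    using U(1) by (auto simp: f_def[abs_def] holomorphic_on_open)
qed

end

lemma set_integral_has_density_on:
  fixes g :: "real \<Rightarrow> complex"
  assumes dens: "has_density_on \<sigma> f U" and sets: "sets \<sigma> = sets borel"
    and U: "open U" and A: "A \<subseteq> U" "A \<in> sets borel" and g: "g \<in> borel_measurable borel"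
  shows "(LINT t:A|\<sigma>. g t) = (LINT t:A|lborel. f t *\<^sub>R g t)"
proof -
  have space: "space \<sigma> = UNIV" using sets_eq_imp_space_eq[OF sets] by simp
  have [measurable]: "U \<in> sets borel" "A \<in> sets borel" "g \<in> borel_measurable borel" 
    using U A g by auto
  define h where "h t = indicator A t *\<^sub>R g t" for t
  have h: "h \<in> borel_measurable (restrict_space lborel U)"
    unfolding h_def by (intro measurable_restrict_space1) measurable
  have ind: "indicator U t *\<^sub>R h t = h t" "indicator U t *\<^sub>R (f t *\<^sub>R h t) = f t *\<^sub>R h t" for t
    using A by (auto simp: h_def indicator_def)
  have "(LINT t:A|\<sigma>. g t) = (\<integral>t. indicator U t *\<^sub>R h t \<partial>\<sigma>)"
    unfolding ind by (simp add: set_lebesgue_integral_def h_def)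
  also have "\<dots> = (\<integral>t. h t \<partial>restrict_space \<sigma> U)"
    by (rule integral_restrict_space[symmetric]) (simp add: sets space)
  also have "\<dots> = (\<integral>t. f t *\<^sub>R h t \<partial>restrict_space lborel U)"
    using dens unfolding has_density_on_def by (simp add: integral_density h)
  also have "\<dots> = (\<integral>t. indicator U t *\<^sub>R (f t *\<^sub>R h t) \<partial>lborel)"
    by (rule integral_restrict_space) simp
  also have "\<dots> = (LINT t:A|lborel. f t *\<^sub>R g t)"
    unfolding ind by (simp add: set_lebesgue_integral_def h_def mult.commute)
  finally show ?thesis .
qed

lemma open_real_section:
  assumes "open \<Omega>"
  shows "open {t. complex_of_real t \<in> \<Omega>}"
  using open_vimage[OF assms continuous_on_of_real_id] by (simp add: vimage_def)

context poisson_finite_measure begin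

text \<open>
  The mass outside \<open>[x\<^sub>0 - r, x\<^sub>0 + r]\<close> and the constant \<open>c\<close> contributed by \<open>t/(t\<^sup>2 + 1)\<close> are harmless;
  the mass inside is a Cauchy integral, whose continuation carries the jump.
\<close>

lemma nevanlinna_integral_local_continuation:
  assumes dens: "has_density_on \<sigma> (\<lambda>t. Re (\<phi> (complex_of_real t))) {t. complex_of_real t \<in> \<Omega>}"
    and \<phi>: "real_holomorphic_on \<phi> \<Omega>" and \<Omega>: "open \<Omega>" and x0: "complex_of_real x0 \<in> \<Omega>"
  obtains r H where "0 < r" "ball (of_real x0) r \<subseteq> \<Omega>" "H holomorphic_on ball (of_real x0) r"
    "\<And>z. z \<in> ball (of_real x0) r \<Longrightarrow> Im z > 0 \<Longrightarrow> (\<integral>t. nevanlinna_kernel z t \<partial>\<sigma>) = H z"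
    "\<And>z. z \<in> ball (of_real x0) r \<Longrightarrow> Im z < 0 \<Longrightarrow>
       (\<integral>t. nevanlinna_kernel z t \<partial>\<sigma>) = H z - 2 * of_real pi * \<i> * \<phi> z"
proof -
  obtain R where R: "0 < R" "ball (complex_of_real x0) R \<subseteq> \<Omega>" using \<Omega> x0 openE by blast
  \<comment> \<open>A smaller radius keeps the closed interval inside the disc on which \<open>\<phi>\<close> is holomorphic.\<close>
  define r where "r = R / 2"
  have r: "0 < r" "r < R" using R by (auto simp: r_def)
  let ?B = "ball (complex_of_real x0) r" and ?I = "{x0 - r..x0 + r}"
  have sub: "?B \<subseteq> \<Omega>" using R r by auto
  have I_sub: "of_real t \<in> \<Omega>" if "t \<in> ?I" for t
    using that R(2) r by (auto simp: dist_norm subset_iff simp flip: of_real_diff)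
  have real: "of_real (Re (\<phi> (of_real t))) = \<phi> (of_real t)" if "t \<in> ?I" for t
    using \<phi> I_sub[OF that] unfolding real_holomorphic_on_def
    by (auto simp: complex_eq_iff dest!: bspec[of _ _ "of_real t"])
  have hol: "\<phi> holomorphic_on \<Omega>" using \<phi> by (simp add: real_holomorphic_on_def)
  obtain H where H: "H holomorphic_on ?B"
    "\<And>z. z \<in> ?B \<Longrightarrow> Im z > 0 \<Longrightarrow>
       ((\<lambda>t. \<phi> (of_real t) / (of_real t - z)) has_integral H z) ?I"
    "\<And>z. z \<in> ?B \<Longrightarrow> Im z < 0 \<Longrightarrow>
       ((\<lambda>t. \<phi> (of_real t) / (of_real t - z)) has_integral (H z - 2 * of_real pi * \<i> * \<phi> z)) ?I"
    using cauchy_integral_local_continuation[OF holomorphic_on_subset[OF hol R(2)] r] by blast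
  have cont: "continuous_on ?I (\<lambda>t. \<phi> (of_real t))"
    by (rule continuous_on_compose2[OF holomorphic_on_imp_continuous_on[OF hol]])
       (use I_sub in \<open>auto intro!: continuous_intros\<close>)
  define E where "E z = (LINT t:-?I|\<sigma>. nevanlinna_kernel z t)" for z
  define c where "c = integral ?I (\<lambda>t. \<phi> (of_real t) * of_real (t / (t\<^sup>2 + 1)))"
  have nz: "t\<^sup>2 + 1 \<noteq> 0" for t :: real
    by (metis add_nonneg_pos less_irrefl zero_le_power2 zero_less_one)
  have main: "(\<integral>t. nevanlinna_kernel z t \<partial>\<sigma>) = E z + J - c"
    if im: "Im z \<noteq> 0" and J: "((\<lambda>t. \<phi> (of_real t) / (of_real t - z)) has_integral J) ?I" for z J
  proof -
    have ne: "of_real t - z \<noteq> 0" for t using im by (auto simp: complex_eq_iff)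
    have int: "set_integrable \<sigma> A (nevanlinna_kernel z)" if "A \<in> sets borel" for A
      using integrable_nevanlinna_kernel[OF im] that
      unfolding set_integrable_def by (intro integrable_mult_indicator) auto
    have "(\<integral>t. nevanlinna_kernel z t \<partial>\<sigma>) = (LINT t:(- ?I) \<union> ?I|\<sigma>. nevanlinna_kernel z t)"
      by (simp add: set_lebesgue_integral_def)
    also have "\<dots> = E z + (LINT t:?I|\<sigma>. nevanlinna_kernel z t)"
      unfolding E_def by (intro set_integral_Un int) auto
    also have "(LINT t:?I|\<sigma>. nevanlinna_kernel z t)
        = (LINT t:?I|lborel. Re (\<phi> (of_real t)) *\<^sub>R nevanlinna_kernel z t)"
      using I_sub \<Omega> by (intro set_integral_has_density_on[OF dens sets_eq] open_real_section) auto
    also have "\<dots> = (LINT t:?I|lborel. \<phi> (of_real t) * nevanlinna_kernel z t)"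
      using real by (intro set_lebesgue_integral_cong) (auto simp: scaleR_conv_of_real)
    also have "\<dots> = integral ?I (\<lambda>t. \<phi> (of_real t) * nevanlinna_kernel z t)"
    proof (rule set_borel_integral_eq_integral, rule borel_integrable_atLeastAtMost')
      show "continuous_on ?I (\<lambda>t. \<phi> (of_real t) * nevanlinna_kernel z t)"
        unfolding nevanlinna_kernel_def using ne nz by (intro continuous_intros cont) auto
    qed
    also have "\<dots> = integral ?I (\<lambda>t. \<phi> (of_real t) / (of_real t - z) - \<phi> (of_real t) * of_real (t / (t\<^sup>2 + 1)))"
      by (simp add: nevanlinna_kernel_def ring_distribs)
    also have "\<dots> = J - c"
    proof -
      have "(\<lambda>t. \<phi> (of_real t) * of_real (t / (t\<^sup>2 + 1))) integrable_on ?I"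
        using nz by (intro integrable_continuous_real continuous_intros cont) auto
      then show ?thesis
        unfolding c_def using J by (auto intro!: integral_unique has_integral_diff)
    qed
    finally show ?thesis by simp
  qed
  show ?thesis
  proof (rule that[of r "\<lambda>z. E z + H z - c"])
    have "E holomorphic_on ?B"
      unfolding E_def
    proof (rule holomorphic_nevanlinna_integral)
      show "complex_of_real t \<notin> ?B" if "t \<in> - ?I" for t
        using that by (auto simp: dist_norm simp flip: of_real_diff)
    qed auto
    then show "(\<lambda>z. E z + H z - c) holomorphic_on ?B"
      by (intro holomorphic_intros H)
    show "(\<integral>t. nevanlinna_kernel z t \<partial>\<sigma>) = E z + H z - c" if "z \<in> ?B" "Im z > 0" for z
      using main[OF _ H(2)] that by simp
    show "(\<integral>t. nevanlinna_kernel z t \<partial>\<sigma>) = E z + H z - c - 2 * of_real pi * \<i> * \<phi> z"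
      if "z \<in> ?B" "Im z < 0" for z
      using main[OF _ H(3)] that by simp
  qed (use r sub in auto)
qed

end

section \<open>Stieltjes inversion\<close>

lemma Im_nevanlinna_kernel: "Im (nevanlinna_kernel (Complex x y) t) = y / ((t - x)\<^sup>2 + y\<^sup>2)"
  by (simp add: nevanlinna_kernel_def complex_diff Im_divide)

lemma nn_integral_poisson_Icc:
  assumes "y > 0" "c \<le> d"
  shows "(\<integral>\<^sup>+ x. ennreal (y / ((t - x)\<^sup>2 + y\<^sup>2)) * indicator {c..d} x \<partial>lborel)
    = ennreal (arctan ((d - t) / y) - arctan ((c - t) / y))"
proof (rule nn_integral_FTC_Icc)
  show "(\<lambda>x. y / ((t - x)\<^sup>2 + y\<^sup>2)) \<in> borel_measurable borel" by measurable
  fix x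
  have "0 < y\<^sup>2 + (x - t)\<^sup>2" using assms by (simp add: add_pos_nonneg)
  then show "((\<lambda>x. arctan ((x - t) / y)) has_real_derivative y / ((t - x)\<^sup>2 + y\<^sup>2)) (at x)"
    using assms
    by (auto intro!: derivative_eq_intros simp: field_simps power2_eq_square)
  show "0 \<le> y / ((t - x)\<^sup>2 + y\<^sup>2)" using assms by simp
qed (use assms in auto)

lemma arctan_dilate_tendsto_sgn: "(\<lambda>n. arctan (a / inverse (real (Suc n)))) \<longlonglongrightarrow> pi / 2 * sgn a"
proof -
  have lim: "filterlim (\<lambda>n. real (Suc n)) at_top sequentially"
    by (rule filterlim_compose[OF filterlim_real_sequentially filterlim_Suc])
  consider "a > 0" | "a = 0" | "a < 0" by linarith
  then show ?thesis
  proof cases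
    case 1
    have "filterlim (\<lambda>n. a * real (Suc n)) at_top sequentially"
      using 1 lim by (intro filterlim_tendsto_pos_mult_at_top[OF tendsto_const])
    then have "(\<lambda>n. arctan (a * real (Suc n))) \<longlonglongrightarrow> pi / 2"
      by (rule filterlim_compose[OF tendsto_arctan_at_top])
    moreover have "pi / 2 * sgn a = pi / 2" using 1 by simp
    ultimately show ?thesis by (simp only: divide_inverse inverse_inverse_eq)
  next
    case 3
    have "filterlim (\<lambda>n. a * real (Suc n)) at_bot sequentially"
      using 3 lim by (intro filterlim_tendsto_neg_mult_at_bot[OF tendsto_const])
    then have "(\<lambda>n. arctan (a * real (Suc n))) \<longlonglongrightarrow> - (pi / 2)"
      by (rule filterlim_compose[OF tendsto_arctan_at_bot])
    moreover have "pi / 2 * sgn a = - (pi / 2)" using 3 by simp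
    ultimately show ?thesis by (simp only: divide_inverse inverse_inverse_eq)
  qed auto
qed

text \<open>
  The dominating function for \<open>y\<close> tending to 0.  For \<open>t\<close> within distance 1 of \<open>[c,d]\<close> the trivial
  bound \<open>\<pi>\<close> is enough; for the other \<open>t\<close> the difference is the integral of the Poisson kernel over
  \<open>[c,d]\<close>, which the uniform kernel bound controls because \<open>t\<close> is at distance at least 1 from the
  points \<open>x + iy\<close> of the segment of integration.
\<close>

lemma arctan_difference_le_poisson_weight:
  fixes c d :: real
  assumes "c \<le> d"
  obtains K where "\<And>y t. 0 < y \<Longrightarrow> y \<le> 1 \<Longrightarrow>
    arctan ((d - t) / y) - arctan ((c - t) / y) \<le> K * (1 / (t\<^sup>2 + 1))"
proof -
  define T where "T = max \<bar>c - 1\<bar> \<bar>d + 1\<bar>"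
  define L where "L = (1 + (T + 1)) * (1 + (1 + (T + 1)) / 1)"
  have L: "0 \<le> L" unfolding L_def T_def by (intro mult_nonneg_nonneg) auto
  show ?thesis
  proof (rule that[of "pi * (T\<^sup>2 + 1) + L * (d - c)"])
    fix y t :: real assume y: "0 < y" "y \<le> 1"
    have pos: "0 < t\<^sup>2 + 1" by (simp add: add_nonneg_pos)
    show "arctan ((d - t) / y) - arctan ((c - t) / y) \<le> (pi * (T\<^sup>2 + 1) + L * (d - c)) * (1 / (t\<^sup>2 + 1))"
    proof (cases "t \<in> {c - 1..d + 1}")
      case True
      then have "\<bar>t\<bar> \<le> T" by (auto simp: T_def)
      then have "t\<^sup>2 \<le> T\<^sup>2" by (metis abs_ge_zero power2_abs power_mono)
      then have "pi * (t\<^sup>2 + 1) \<le> pi * (T\<^sup>2 + 1)" by (intro mult_left_mono) auto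
      moreover have "0 \<le> L * (d - c)" using L assms by simp
      ultimately have "pi * (t\<^sup>2 + 1) \<le> pi * (T\<^sup>2 + 1) + L * (d - c)" by linarith
      then have "pi \<le> (pi * (T\<^sup>2 + 1) + L * (d - c)) * (1 / (t\<^sup>2 + 1))"
        using pos by (simp add: pos_le_divide_eq)
      moreover have "arctan ((d - t) / y) - arctan ((c - t) / y) \<le> pi"
        using arctan_ubound[of "(d - t) / y"] arctan_lbound[of "(c - t) / y"] by linarith
      ultimately show ?thesis by linarith
    next
      case False
      have "ennreal (arctan ((d - t) / y) - arctan ((c - t) / y))
        = (\<integral>\<^sup>+ x. ennreal (y / ((t - x)\<^sup>2 + y\<^sup>2)) * indicator {c..d} x \<partial>lborel)"
        using y assms by (simp add: nn_integral_poisson_Icc)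
      also have "\<dots> \<le> (\<integral>\<^sup>+ x. ennreal (L * (1 / (t\<^sup>2 + 1))) * indicator {c..d} x \<partial>lborel)"
      proof (rule nn_integral_mono)
        fix x
        show "ennreal (y / ((t - x)\<^sup>2 + y\<^sup>2)) * indicator {c..d} x \<le> ennreal (L * (1 / (t\<^sup>2 + 1))) * indicator {c..d} x"
        proof (cases "x \<in> {c..d}")
          case True
          have "cmod (Complex x y) \<le> T + 1"
            using True y cmod_le[of "Complex x y"] by (auto simp: T_def)
          moreover have "1 \<le> cmod (of_real t - Complex x y)"
            using True False abs_Re_le_cmod[of "of_real t - Complex x y"] by auto
          ultimately have "cmod (nevanlinna_kernel (Complex x y) t) \<le> L * (1 / (t\<^sup>2 + 1))"
            unfolding L_def by (intro norm_nevanlinna_kernel_le) auto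
          then have "y / ((t - x)\<^sup>2 + y\<^sup>2) \<le> L * (1 / (t\<^sup>2 + 1))"
            using abs_Im_le_cmod[of "nevanlinna_kernel (Complex x y) t"]
            unfolding Im_nevanlinna_kernel by linarith
          then show ?thesis using True by (simp add: ennreal_leI)
        qed simp
      qed
      also have "\<dots> = ennreal (L * (1 / (t\<^sup>2 + 1)) * (d - c))"
        using assms L pos by (simp add: nn_integral_cmult_indicator ennreal_mult[symmetric])
      finally have "arctan ((d - t) / y) - arctan ((c - t) / y) \<le> L * (1 / (t\<^sup>2 + 1)) * (d - c)"
        using assms L pos by (subst (asm) ennreal_le_iff) auto
      also have "\<dots> \<le> (pi * (T\<^sup>2 + 1) + L * (d - c)) * (1 / (t\<^sup>2 + 1))"
        using pos by (simp add: field_simps add_nonneg_nonneg)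
      finally show ?thesis .
    qed
  qed
qed

context poisson_finite_measure begin

lemma emeasure_Icc_finite: "emeasure \<sigma> {c..d} < \<infinity>"
proof -
  define T where "T = max \<bar>c\<bar> \<bar>d\<bar>"
  have "emeasure \<sigma> {c..d} = (\<integral>\<^sup>+ t. indicator {c..d} t \<partial>\<sigma>)" by simp
  also have "\<dots> \<le> (\<integral>\<^sup>+ t. ennreal (T\<^sup>2 + 1) * ennreal (1 / (t\<^sup>2 + 1)) \<partial>\<sigma>)"
  proof (rule nn_integral_mono)
    fix t
    show "indicator {c..d} t \<le> ennreal (T\<^sup>2 + 1) * ennreal (1 / (t\<^sup>2 + 1))"
    proof (cases "t \<in> {c..d}")
      case True
      then have "\<bar>t\<bar> \<le> T" by (auto simp: T_def)
      then have "t\<^sup>2 \<le> T\<^sup>2" by (metis abs_ge_zero power2_abs power_mono)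
      moreover have "0 < t\<^sup>2 + 1" by (simp add: add_nonneg_pos)
      ultimately have "1 \<le> (T\<^sup>2 + 1) * (1 / (t\<^sup>2 + 1))" by (simp add: pos_le_divide_eq)
      then have "ennreal 1 \<le> ennreal ((T\<^sup>2 + 1) * (1 / (t\<^sup>2 + 1)))" by (rule ennreal_leI)
      also have "\<dots> = ennreal (T\<^sup>2 + 1) * ennreal (1 / (t\<^sup>2 + 1))" by (rule ennreal_mult) auto
      finally show ?thesis using True by simp
    qed simp
  qed
  also have "\<dots> < \<infinity>"
    using poisson_finite by (simp add: nn_integral_cmult ennreal_mult_less_top)
  finally show ?thesis .
qed

lemma sigma_finite: "sigma_finite_measure \<sigma>"
proof
  have "(\<Union>n. {- real n..real n}) = UNIV"
    by (auto, metis abs_le_iff minus_le_iff real_arch_simple)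
  then show "\<exists>A. countable A \<and> A \<subseteq> sets \<sigma> \<and> \<Union>A = space \<sigma> \<and> (\<forall>a\<in>A. emeasure \<sigma> a \<noteq> \<infinity>)"
    using emeasure_Icc_finite sets_eq_imp_space_eq[OF sets_eq]
    by (intro exI[of _ "range (\<lambda>n. {- real n..real n})"]) (auto simp: less_top[symmetric] less_imp_neq)
qed

lemma nn_integral_poisson_kernel:
  assumes "y > 0"
  shows "(\<integral>\<^sup>+ t. ennreal (y / ((t - x)\<^sup>2 + y\<^sup>2)) \<partial>\<sigma>)
    = ennreal (Im (\<integral>t. nevanlinna_kernel (Complex x y) t \<partial>\<sigma>))"
proof -
  have "integrable \<sigma> (nevanlinna_kernel (Complex x y))"
    using assms by (intro integrable_nevanlinna_kernel) simp
  then have "(\<integral>\<^sup>+ t. ennreal (Im (nevanlinna_kernel (Complex x y) t)) \<partial>\<sigma>)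
    = ennreal (\<integral>t. Im (nevanlinna_kernel (Complex x y) t) \<partial>\<sigma>)"
    using assms by (intro nn_integral_eq_integral integrable_Im AE_I2) (simp_all add: Im_nevanlinna_kernel)
  then show ?thesis
    unfolding integral_Im[OF \<open>integrable \<sigma> _\<close>] by (simp add: Im_nevanlinna_kernel)
qed

text \<open>
  The Poisson kernel is nonnegative, so Tonelli's theorem exchanges the two integrals.
\<close>

lemma nn_integral_Im_nevanlinna_Icc:
  assumes "y > 0" "c \<le> d"
  shows "(\<integral>\<^sup>+ x. ennreal (Im (\<integral>t. nevanlinna_kernel (Complex x y) t \<partial>\<sigma>)) * indicator {c..d} x \<partial>lborel)
    = (\<integral>\<^sup>+ t. ennreal (arctan ((d - t) / y) - arctan ((c - t) / y)) \<partial>\<sigma>)"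
proof -
  interpret \<sigma>: sigma_finite_measure \<sigma> by (rule sigma_finite)
  interpret pair_sigma_finite lborel \<sigma> ..
  have "(\<integral>\<^sup>+ x. ennreal (Im (\<integral>t. nevanlinna_kernel (Complex x y) t \<partial>\<sigma>)) * indicator {c..d} x \<partial>lborel)
    = (\<integral>\<^sup>+ x. (\<integral>\<^sup>+ t. ennreal (y / ((t - x)\<^sup>2 + y\<^sup>2)) * indicator {c..d} x \<partial>\<sigma>) \<partial>lborel)"
    using assms by (simp add: nn_integral_multc nn_integral_poisson_kernel)
  also have "\<dots> = (\<integral>\<^sup>+ t. (\<integral>\<^sup>+ x. ennreal (y / ((t - x)\<^sup>2 + y\<^sup>2)) * indicator {c..d} x \<partial>lborel) \<partial>\<sigma>)"
    by (rule Fubini'[symmetric]) measurable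
  finally show ?thesis using assms by (simp add: nn_integral_poisson_Icc)
qed

text \<open>
  The limiting integrand \<open>\<pi>/2 (sgn (d - t) - sgn (c - t))\<close> is \<open>\<pi>\<close> on the open interval, \<open>\<pi>/2\<close> at its two
  ends and 0 outside, when \<open>c < d\<close>.
\<close>

lemma stieltjes_inversion_limit:
  assumes "c \<le> d"
  shows "(\<lambda>n. \<integral>\<^sup>+ x. ennreal (Im (\<integral>t. nevanlinna_kernel (Complex x (inverse (real (Suc n)))) t \<partial>\<sigma>))
             * indicator {c..d} x \<partial>lborel)
    \<longlonglongrightarrow> (\<integral>\<^sup>+ t. ennreal (pi / 2 * (sgn (d - t) - sgn (c - t))) \<partial>\<sigma>)"
proof -
  obtain K where K: "\<And>y t. 0 < y \<Longrightarrow> y \<le> 1 \<Longrightarrow>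
    arctan ((d - t) / y) - arctan ((c - t) / y) \<le> K * (1 / (t\<^sup>2 + 1))"
    using arctan_difference_le_poisson_weight[OF assms] by blast
  let ?u = "\<lambda>n t. ennreal (arctan ((d - t) / inverse (real (Suc n))) - arctan ((c - t) / inverse (real (Suc n))))"
  have "(\<lambda>n. \<integral>\<^sup>+ t. ?u n t \<partial>\<sigma>) \<longlonglongrightarrow> (\<integral>\<^sup>+ t. ennreal (pi / 2 * (sgn (d - t) - sgn (c - t))) \<partial>\<sigma>)"
  proof (rule nn_integral_dominated_convergence[where w = "\<lambda>t. ennreal (\<bar>K\<bar> * (1 / (t\<^sup>2 + 1)))"])
    show "AE t in \<sigma>. ?u n t \<le> ennreal (\<bar>K\<bar> * (1 / (t\<^sup>2 + 1)))" for n
    proof (intro AE_I2 ennreal_leI)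
      fix t
      have "arctan ((d - t) / inverse (real (Suc n))) - arctan ((c - t) / inverse (real (Suc n))) \<le> K * (1 / (t\<^sup>2 + 1))"
        by (rule K) (auto simp: field_simps)
      also have "\<dots> \<le> \<bar>K\<bar> * (1 / (t\<^sup>2 + 1))" by (intro mult_right_mono) auto
      finally show "arctan ((d - t) / inverse (real (Suc n))) - arctan ((c - t) / inverse (real (Suc n))) \<le> \<bar>K\<bar> * (1 / (t\<^sup>2 + 1))" .
    qed
    show "(\<integral>\<^sup>+ t. ennreal (\<bar>K\<bar> * (1 / (t\<^sup>2 + 1))) \<partial>\<sigma>) < \<infinity>"
      using poisson_finite by (simp add: ennreal_mult nn_integral_cmult ennreal_mult_less_top del: times_divide_eq_right)
    have "(\<lambda>n. arctan ((d - t) / inverse (real (Suc n))) - arctan ((c - t) / inverse (real (Suc n))))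
        \<longlonglongrightarrow> pi / 2 * (sgn (d - t) - sgn (c - t))" for t
      using tendsto_diff[OF arctan_dilate_tendsto_sgn arctan_dilate_tendsto_sgn, of "d - t" "c - t"]
      by (simp only: right_diff_distrib)
    then show "AE t in \<sigma>. (\<lambda>n. ?u n t) \<longlonglongrightarrow> ennreal (pi / 2 * (sgn (d - t) - sgn (c - t)))"
      by (intro AE_I2 tendsto_ennrealI)
  qed measurable
  then show ?thesis using assms by (subst nn_integral_Im_nevanlinna_Icc) auto
qed

text \<open>
  Where the imaginary part extends continuously to the boundary, the other side of the inversion
  formula converges too: \<open>G\<close> is bounded on the compact rectangle over \<open>[c,d]\<close>.
\<close>

lemma stieltjes_inversion_continuous_boundary:
  fixes G :: "complex \<Rightarrow> real"
  assumes "c \<le> d"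
    and cont: "continuous_on (cbox (Complex c 0) (Complex d 1)) G"
    and G: "\<And>z. z \<in> cbox (Complex c 0) (Complex d 1) \<Longrightarrow> Im z > 0 \<Longrightarrow>
      G z = Im (\<integral>t. nevanlinna_kernel z t \<partial>\<sigma>)"
  shows "(\<integral>\<^sup>+ x. ennreal (G (of_real x)) * indicator {c..d} x \<partial>lborel)
    = (\<integral>\<^sup>+ t. ennreal (pi / 2 * (sgn (d - t) - sgn (c - t))) \<partial>\<sigma>)"
proof -
  let ?Q = "cbox (Complex c 0) (Complex d 1)"
  define y where "y n = inverse (real (Suc n))" for n
  have y: "0 < y n" "y n \<le> 1" for n
    by (auto simp: y_def field_simps)
  have y0: "y \<longlonglongrightarrow> 0"
    unfolding y_def[abs_def] by (rule LIMSEQ_inverse_real_of_nat)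
  have Q: "Complex x (y n) \<in> ?Q" "Complex x 0 \<in> ?Q" if "x \<in> {c..d}" for x n
    using that y[of n] by (auto simp: in_cbox_complex_iff)
  have "bounded (G ` ?Q)"
    by (intro compact_imp_bounded compact_continuous_image cont compact_cbox)
  then obtain B where B: "\<And>z. z \<in> ?Q \<Longrightarrow> G z \<le> B"
    unfolding bounded_real by (metis abs_le_D1 imageI)
  have meas: "(\<lambda>x. ennreal (G (Complex x v)) * indicator {c..d} x) \<in> borel_measurable lborel"
    if "0 \<le> v" "v \<le> 1" for v
  proof -
    have "continuous_on {c..d} (\<lambda>x. G (Complex x v))"
    proof (rule continuous_on_compose2[OF cont])
      show "continuous_on {c..d} (\<lambda>x. Complex x v)"
        unfolding Complex_eq by (intro continuous_intros)
    qed (use that in \<open>auto simp: in_cbox_complex_iff\<close>)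
    then have "(\<lambda>x. indicator {c..d} x *\<^sub>R G (Complex x v)) \<in> borel_measurable borel"
      by (intro borel_measurable_continuous_on_indicator) auto
    then have "(\<lambda>x. ennreal (indicator {c..d} x *\<^sub>R G (Complex x v))) \<in> borel_measurable lborel"
      by simp
    also have "(\<lambda>x. ennreal (indicator {c..d} x *\<^sub>R G (Complex x v))) = (\<lambda>x. ennreal (G (Complex x v)) * indicator {c..d} x)"
      by (auto simp: indicator_def)
    finally show ?thesis .
  qed
  have "(\<lambda>n. \<integral>\<^sup>+ x. ennreal (G (Complex x (y n))) * indicator {c..d} x \<partial>lborel)
    \<longlonglongrightarrow> (\<integral>\<^sup>+ x. ennreal (G (Complex x 0)) * indicator {c..d} x \<partial>lborel)"
  proof (rule nn_integral_dominated_convergence[where w = "\<lambda>x. ennreal B * indicator {c..d} x"])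
    show "(\<integral>\<^sup>+ x. ennreal B * indicator {c..d} x \<partial>lborel) < \<infinity>"
      using assms(1) by (simp add: nn_integral_cmult_indicator ennreal_mult_less_top)
    show "AE x in lborel. ennreal (G (Complex x (y n))) * indicator {c..d} x \<le> ennreal B * indicator {c..d} x" for n
      using Q B by (auto simp: indicator_def ennreal_leI)
    have "(\<lambda>n. G (Complex x (y n))) \<longlonglongrightarrow> G (Complex x 0)" if "x \<in> {c..d}" for x
    proof (rule continuous_on_tendsto_compose[OF cont])
      show "(\<lambda>n. Complex x (y n)) \<longlonglongrightarrow> Complex x 0" by (intro tendsto_Complex tendsto_const y0)
    qed (use Q that in auto)
    then show "AE x in lborel. (\<lambda>n. ennreal (G (Complex x (y n))) * indicator {c..d} x)
        \<longlonglongrightarrow> ennreal (G (Complex x 0)) * indicator {c..d} x"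
      by (auto simp: indicator_def intro!: tendsto_ennrealI)
    show "(\<lambda>x. ennreal (G (Complex x (y n))) * indicator {c..d} x) \<in> borel_measurable lborel" for n
      using meas[of "y n"] y[of n] by simp
    show "(\<lambda>x. ennreal (G (Complex x 0)) * indicator {c..d} x) \<in> borel_measurable lborel"
      using meas[of 0] by simp
  qed auto
  moreover have "(\<integral>\<^sup>+ x. ennreal (G (Complex x (y n))) * indicator {c..d} x \<partial>lborel)
    = (\<integral>\<^sup>+ x. ennreal (Im (\<integral>t. nevanlinna_kernel (Complex x (inverse (real (Suc n)))) t \<partial>\<sigma>))
             * indicator {c..d} x \<partial>lborel)" for n
    unfolding y_def[symmetric] using Q y by (intro nn_integral_cong) (auto simp: indicator_def G)
  ultimately have "(\<integral>\<^sup>+ x. ennreal (G (Complex x 0)) * indicator {c..d} x \<partial>lborel)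
    = (\<integral>\<^sup>+ t. ennreal (pi / 2 * (sgn (d - t) - sgn (c - t))) \<partial>\<sigma>)"
    using stieltjes_inversion_limit[OF assms(1)] LIMSEQ_unique by simp
  then show ?thesis by (simp add: complex_of_real_def)
qed

end

section \<open>Recovering the density from compact intervals\<close>

text \<open>
  On one compact interval \<open>I\<close> a finite measure is determined by its tails \<open>I \<inter> {x<..}\<close>, each of which is
  empty, all of \<open>I\<close>, or a compact interval with its left end removed.  Countably many compact intervals exhaust \<open>U\<close>, and
  countable additivity glues the local equalities after the cover has been made disjoint.
\<close>

lemma emeasure_eq_on_open_of_compact_intervals:
  fixes \<mu> \<nu> :: "real measure"
  assumes sets: "sets \<mu> = sets borel" "sets \<nu> = sets borel" and U: "open U"
    and fin: "\<And>c d. {c..d} \<subseteq> U \<Longrightarrow> emeasure \<mu> {c..d} < \<infinity>"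
    and eq: "\<And>c d. {c..d} \<subseteq> U \<Longrightarrow> emeasure \<mu> {c..d} = emeasure \<nu> {c..d}"
    and A: "A \<in> sets borel" "A \<subseteq> U"
  shows "emeasure \<mu> A = emeasure \<nu> A"
proof -
  have local: "emeasure \<mu> (I \<inter> X) = emeasure \<nu> (I \<inter> X)"
    if I: "I = {c..d}" "I \<subseteq> U" and X: "X \<in> sets borel" for I X and c d :: real
  proof -
    have tail: "emeasure \<rho> (I \<inter> {x<..}) =
        (if x \<in> I then emeasure \<rho> {x..d} - emeasure \<rho> {x..x} else if x < c then emeasure \<rho> I else 0)"
      if \<rho>: "\<rho> = \<mu> \<or> \<rho> = \<nu>" for \<rho> x
    proof (cases "x \<in> I")
      case True
      then have "{x..x} \<subseteq> U" using I by auto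
      then have "emeasure \<rho> {x} \<noteq> \<infinity>" using fin[of x x] eq[of x x] \<rho> by auto
      moreover have "I \<inter> {x<..} = {x..d} - {x}" using True I by auto
      ultimately show ?thesis using True I \<rho> sets by (subst emeasure_Diff[symmetric]) auto
    next
      case False
      then have "I \<inter> {x<..} = (if x < c then I else {})" using I by auto
      with False show ?thesis by auto
    qed
    have "density \<mu> (indicator I) = density \<nu> (indicator I)"
    proof (rule measure_eqI_lessThan)
      fix x :: real
      have sub: "{x..d} \<subseteq> U" "{x..x} \<subseteq> U" if "x \<in> I" using that I by auto
      have "emeasure \<mu> (I \<inter> {x<..}) = emeasure \<nu> (I \<inter> {x<..})"
        unfolding tail[OF disjI1[OF refl]] tail[OF disjI2[OF refl]]
        using eq[OF sub(1)] eq[OF sub(2)] eq[of c d] I by simp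
      then show "emeasure (density \<mu> (indicator I)) {x<..} = emeasure (density \<nu> (indicator I)) {x<..}"
        using I sets by (simp add: emeasure_restricted)
      have "emeasure \<mu> (I \<inter> {x<..}) \<le> emeasure \<mu> I"
        using I sets by (intro emeasure_mono) auto
      also have "\<dots> < \<infinity>" using fin I by simp
      finally show "emeasure (density \<mu> (indicator I)) {x<..} < \<infinity>"
        using I sets by (simp add: emeasure_restricted)
    qed (use sets in auto)
    then show ?thesis
      using I X sets emeasure_restricted[of I \<mu> X] emeasure_restricted[of I \<nu> X] by simp
  qed
  obtain \<D> where \<D>: "countable \<D>" "\<D> \<subseteq> Pow U" "\<And>X. X \<in> \<D> \<Longrightarrow> \<exists>c d. X = cbox c d" "\<Union>\<D> = U"
    using open_countable_Union_open_cbox[OF U] by blast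
  define I where "I = from_nat_into (insert {} \<D>)"
  have I_in: "I n \<in> insert {} \<D>" for n unfolding I_def by (rule from_nat_into) simp
  have I_range: "range I = insert {} \<D>" unfolding I_def using \<D>(1) by (intro range_from_nat_into) auto
  have I: "\<exists>c d. I n = {c..d}" for n
  proof (cases "I n = {}")
    case True
    then have "I n = {1..0}" by simp
    then show ?thesis by blast
  next
    case False
    then show ?thesis using I_in[of n] \<D>(3)[of "I n"] by auto
  qed
  have I_sub: "I n \<subseteq> U" for n using I_in[of n] \<D>(2) by auto
  define P where "P n = A \<inter> disjointed I n" for n
  have Isets: "range I \<subseteq> sets borel" using I by (auto, metis atLeastAtMost_borel)
  then have dj: "disjointed I n \<in> sets borel" for n
    using sets.range_disjointed_sets[of I borel] by auto
  have P: "P n \<in> sets borel" "P n = I n \<inter> P n" for n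
    using A dj disjointed_subset[of I n] by (auto simp: P_def)
  have "disjoint_family P"
    using disjoint_family_disjointed[of I] unfolding disjoint_family_on_def P_def by blast
  moreover have "(\<Union>n. P n) = A"
  proof -
    have "(\<Union>n. P n) = A \<inter> (\<Union>n. I n)" by (simp add: P_def UN_disjointed_eq)
    also have "(\<Union>n. I n) = U" using \<D>(4) by (simp add: I_range)
    finally show ?thesis using A by auto
  qed
  moreover have "emeasure \<mu> (P n) = emeasure \<nu> (P n)" for n
    using I[of n] local[of "I n" _ _ "P n"] I_sub P by metis
  ultimately show ?thesis
    using suminf_emeasure[of P \<mu>] suminf_emeasure[of P \<nu>] P sets by (simp add: image_subset_iff)
qed

context poisson_finite_measure begin

text \<open>
  If \<open>\<sigma>\<close> had an atom at \<open>c\<close>, the inversion formula on \<open>[c, c + h]\<close> would bound \<open>\<pi>/2\<close> times its mass by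
  \<open>h\<close> times a local bound of \<open>g\<close>, for all small \<open>h\<close>.  Without atoms the half weights at the ends of
  the interval disappear, and the formula states that \<open>\<sigma>\<close> and the measure with density \<open>g/\<pi>\<close> agree on
  compact intervals.
\<close>

lemma has_density_on_of_stieltjes_inversion:
  assumes U: "open U" and g: "continuous_on U g" "\<And>x. x \<in> U \<Longrightarrow> 0 \<le> g x"
    and inversion: "\<And>c d. c < d \<Longrightarrow> {c..d} \<subseteq> U \<Longrightarrow>
      (\<integral>\<^sup>+ x. ennreal (g x) * indicator {c..d} x \<partial>lborel)
      = (\<integral>\<^sup>+ t. ennreal (pi / 2 * (sgn (d - t) - sgn (c - t))) \<partial>\<sigma>)"
  shows "has_density_on \<sigma> (\<lambda>t. g t / pi) U"
proof -
  have no_atom: "emeasure \<sigma> {c} = 0" if c: "c \<in> U" for c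
  proof -
    obtain e where e: "0 < e" "cball c e \<subseteq> U" using U c open_contains_cball by blast
    then have sub: "{c..c + h} \<subseteq> U" if "h \<le> e" for h
      using that by (auto simp: subset_iff dist_real_def)
    have "compact (g ` {c..c + e})"
      using g(1) sub[of e] by (intro compact_continuous_image) (auto elim: continuous_on_subset)
    then have "bounded (g ` {c..c + e})" by (rule compact_imp_bounded)
    then obtain B where B: "0 < B" "\<And>x. x \<in> {c..c + e} \<Longrightarrow> g x \<le> B"
      unfolding bounded_pos real_norm_def by (metis abs_le_D1 imageI)
    define m where "m = measure \<sigma> {c}"
    have m: "emeasure \<sigma> {c} = ennreal m"
      using emeasure_Icc_finite[of c c] unfolding m_def by (intro emeasure_eq_ennreal_measure) auto
    have le: "pi / 2 * m \<le> B * h" if h: "0 < h" "h \<le> e" for h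
    proof -
      have "ennreal (pi / 2 * m) = (\<integral>\<^sup>+ t. ennreal (pi / 2) * indicator {c} t \<partial>\<sigma>)"
        by (simp add: nn_integral_cmult_indicator m ennreal_mult[symmetric] m_def)
      also have "\<dots> \<le> (\<integral>\<^sup>+ t. ennreal (pi / 2 * (sgn (c + h - t) - sgn (c - t))) \<partial>\<sigma>)"
        using h by (intro nn_integral_mono) (auto simp: indicator_def)
      also have "\<dots> = (\<integral>\<^sup>+ x. ennreal (g x) * indicator {c..c + h} x \<partial>lborel)"
        using h sub by (intro inversion[symmetric]) auto
      also have "\<dots> \<le> (\<integral>\<^sup>+ x. ennreal B * indicator {c..c + h} x \<partial>lborel)"
        using h B by (intro nn_integral_mono) (auto simp: indicator_def intro!: ennreal_leI)
      also have "\<dots> = ennreal (B * h)"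
        using h B by (simp add: nn_integral_cmult_indicator ennreal_mult)
      finally show ?thesis using h B by simp
    qed
    have "m \<le> 0"
    proof (rule ccontr)
      assume "\<not> m \<le> 0"
      then have m_pos: "0 < m" by simp
      \<comment> \<open>Half of \<open>\<pi> m / (2 B)\<close>, the step below which the inequality \<open>le\<close> fails.\<close>
      define h where "h = min e (pi * m / (4 * B))"
      have "pi / 2 * m \<le> B * h" using m_pos B e by (intro le) (auto simp: h_def)
      also have "\<dots> \<le> B * (pi * m / (4 * B))" using B by (intro mult_left_mono) (auto simp: h_def)
      also have "\<dots> = pi * m / 4" using B by simp
      finally show False using mult_pos_pos[OF pi_gt_zero m_pos] by linarith
    qed
    then show ?thesis by (simp add: m ennreal_neg)
  qed
  define q where "q x = ennreal (indicator U x *\<^sub>R (g x / pi))" for x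
  have U_borel [measurable]: "U \<in> sets borel" using U by auto
  have q [measurable]: "q \<in> borel_measurable borel"
    unfolding q_def[abs_def]
    by (intro measurable_compose[OF _ measurable_ennreal] borel_measurable_continuous_on_indicator continuous_intros g) auto
  define \<nu> where "\<nu> = density lborel q"
  have \<nu>: "emeasure \<nu> A = (\<integral>\<^sup>+ x. q x * indicator A x \<partial>lborel)" if "A \<in> sets borel" for A
    unfolding \<nu>_def using that by (intro emeasure_density) auto
  have Icc: "emeasure \<sigma> {c..d} = emeasure \<nu> {c..d}" if sub: "{c..d} \<subseteq> U" for c d
  proof -
    consider "c < d" | "c = d" | "c > d" by linarith
    then show ?thesis
    proof cases
      case 1
      then have cd: "c \<in> U" "d \<in> U" using sub by auto
      have "{c} \<in> null_sets \<sigma>" "{d} \<in> null_sets \<sigma>" using cd no_atom by auto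
      then have ends: "AE t in \<sigma>. t \<noteq> c" "AE t in \<sigma>. t \<noteq> d" using AE_not_in by fastforce+
      have "ennreal pi * emeasure \<sigma> {c..d} = (\<integral>\<^sup>+ t. ennreal pi * indicator {c..d} t \<partial>\<sigma>)"
        by (simp add: nn_integral_cmult_indicator)
      also have "\<dots> = (\<integral>\<^sup>+ t. ennreal (pi / 2 * (sgn (d - t) - sgn (c - t))) \<partial>\<sigma>)"
      proof (rule nn_integral_cong_AE)
        show "AE t in \<sigma>. ennreal pi * indicator {c..d} t = ennreal (pi / 2 * (sgn (d - t) - sgn (c - t)))"
          using ends by eventually_elim (use 1 in \<open>auto simp: indicator_def sgn_if\<close>)
      qed
      also have "\<dots> = (\<integral>\<^sup>+ x. ennreal (g x) * indicator {c..d} x \<partial>lborel)"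
        using 1 sub by (intro inversion[symmetric])
      also have "\<dots> = (\<integral>\<^sup>+ x. ennreal pi * (q x * indicator {c..d} x) \<partial>lborel)"
        using sub g(2)
        by (intro nn_integral_cong) (auto simp: q_def indicator_def ennreal_mult[symmetric] subset_iff)
      also have "\<dots> = ennreal pi * emeasure \<nu> {c..d}"
        by (simp add: \<nu> nn_integral_cmult)
      finally show ?thesis by (simp add: ennreal_mult_cancel_left)
    next
      case 2
      have "AE x in lborel. q x * indicator {c} x = 0"
        using AE_lborel_singleton[of c] by eventually_elim auto
      then have "(\<integral>\<^sup>+ x. q x * indicator {c} x \<partial>lborel) = (\<integral>\<^sup>+ (x::real). 0 \<partial>lborel)"
        by (rule nn_integral_cong_AE)
      then have "emeasure \<nu> {c} = 0" by (simp add: \<nu>)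
      moreover have "emeasure \<sigma> {c} = 0" using 2 sub by (intro no_atom) auto
      ultimately show ?thesis using 2 by simp
    next
      case 3
      then have "{c..d} = {}" by simp
      then show ?thesis by simp
    qed
  qed
  have agree: "emeasure \<sigma> A = (\<integral>\<^sup>+ x. q x * indicator A x \<partial>lborel)" if "A \<in> sets borel" "A \<subseteq> U" for A
  proof -
    have "sets \<nu> = sets borel" by (simp add: \<nu>_def)
    from emeasure_eq_on_open_of_compact_intervals[OF sets_eq this U emeasure_Icc_finite Icc that]
    show ?thesis using that(1) by (simp only: \<nu>)
  qed
  have f_meas: "(\<lambda>t. g t / pi) \<in> borel_measurable (restrict_space lborel U)"
  proof -
    have "(\<lambda>t. g t / pi) \<in> borel_measurable (restrict_space borel U)"
      by (intro borel_measurable_continuous_on_restrict continuous_intros g) auto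
    then show ?thesis by (simp cong: measurable_cong_sets sets_restrict_space_cong)
  qed
  have space: "space \<sigma> = UNIV" using sets_eq_imp_space_eq[OF sets_eq] by simp
  have "restrict_space \<sigma> U = density (restrict_space lborel U) (\<lambda>t. ennreal (g t / pi))"
  proof (rule measure_eqI)
    show "sets (restrict_space \<sigma> U) = sets (density (restrict_space lborel U) (\<lambda>t. ennreal (g t / pi)))"
      by (simp add: sets_restrict_space)
    fix A assume "A \<in> sets (restrict_space \<sigma> U)"
    then have A: "A \<in> sets borel" "A \<subseteq> U" "A \<in> sets (restrict_space lborel U)"
      by (auto simp: sets_restrict_space)
    have "emeasure (restrict_space \<sigma> U) A = (\<integral>\<^sup>+ x. q x * indicator A x \<partial>lborel)"
      using A agree by (subst emeasure_restrict_space) (auto simp: space)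
    also have "\<dots> = (\<integral>\<^sup>+ x. ennreal (g x / pi) * indicator A x * indicator U x \<partial>lborel)"
      using A by (intro nn_integral_cong) (auto simp: q_def indicator_def)
    also have "\<dots> = (\<integral>\<^sup>+ x. ennreal (g x / pi) * indicator A x \<partial>restrict_space lborel U)"
      by (rule nn_integral_restrict_space[symmetric]) simp
    also have "\<dots> = emeasure (density (restrict_space lborel U) (\<lambda>t. ennreal (g t / pi))) A"
      using A f_meas by (intro emeasure_density[symmetric]) auto
    finally show "emeasure (restrict_space \<sigma> U) A = \<dots>" .
  qed
  moreover have "AE t in restrict_space lborel U. 0 \<le> g t / pi"
    by (intro AE_I2) (use g(2) in \<open>auto simp: space_restrict_space\<close>)
  ultimately show ?thesis using f_meas by (simp add: has_density_on_def)
qed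

end

section \<open>Continuation and density\<close>

lemma at_within_upper_half_plane_nontrivial:
  "at (complex_of_real x) within {z. Im z > 0} \<noteq> bot"
  unfolding trivial_limit_within islimpt_approachable not_not
proof (intro allI impI)
  fix e :: real assume e: "0 < e"
  have "dist (of_real x + \<i> * of_real (e / 2)) (complex_of_real x) = e / 2"
    using e by (simp add: dist_norm norm_mult norm_divide)
  then show "\<exists>z\<in>{z. 0 < Im z}. z \<noteq> of_real x \<and> dist z (of_real x) < e"
    using e by (intro bexI[of _ "of_real x + \<i> * of_real (e / 2)"]) (auto simp: complex_eq_iff)
qed

context poisson_finite_measure begin

text \<open>
  The function \<open>\<phi>\<close> is \<open>1/(2\<pi>i)\<close> times the difference of \<open>F\<close> and its reflection; on the real axis this
  is \<open>Im F / \<pi>\<close>.  The rectangle above a compact interval in \<open>\<Omega> \<inter> \<real>\<close> lies in \<open>\<Omega> \<union> \<complex>\<^sup>+\<close>, so \<open>Im F\<close>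
  minus the linear term is the continuous boundary extension that Stieltjes inversion asks for.
\<close>

lemma continuation_imp_density:
  assumes M: "\<And>z. Im z > 0 \<Longrightarrow> M z = of_real a + of_real b * z + (\<integral>t. nevanlinna_kernel z t \<partial>\<sigma>)"
    and pos: "\<And>z. Im z > 0 \<Longrightarrow> Im (M z) \<ge> 0"
    and \<Omega>: "open \<Omega>" "symmetric_wrt_reals \<Omega>"
    and F: "F holomorphic_on (\<Omega> \<union> {z. Im z > 0})" "\<And>z. Im z > 0 \<Longrightarrow> F z = M z"
  shows "\<exists>\<phi>. real_holomorphic_on \<phi> \<Omega> \<and>
      has_density_on \<sigma> (\<lambda>t. Re (\<phi> (complex_of_real t))) {t. complex_of_real t \<in> \<Omega>}"
proof (intro exI conjI)
  let ?U = "{t. complex_of_real t \<in> \<Omega>}"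
  define \<phi> where "\<phi> z = (F z - cnj (F (cnj z))) / (2 * of_real pi * \<i>)" for z
  have cont: "continuous_on (\<Omega> \<union> {z. Im z > 0}) F" by (rule holomorphic_on_imp_continuous_on[OF F(1)])
  have F\<Omega>: "F holomorphic_on \<Omega>" using F(1) by (rule holomorphic_on_subset) auto
  have "cnj ` \<Omega> = \<Omega>"
    using \<Omega>(2) by (auto simp: image_cnj_conv_vimage_cnj symmetric_wrt_reals_def)
  then have "(cnj \<circ> F \<circ> cnj) holomorphic_on \<Omega>"
    using F\<Omega> \<Omega>(1) by (intro holomorphic_on_compose_cnj_cnj) auto
  then have "(\<lambda>z. cnj (F (cnj z))) holomorphic_on \<Omega>" by (simp add: o_def)
  then have "\<phi> holomorphic_on \<Omega>"
    unfolding \<phi>_def by (intro holomorphic_intros F\<Omega>) auto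
  moreover have "cnj (\<phi> (cnj z)) = \<phi> z" for z
    by (simp add: \<phi>_def divide_simps)
  ultimately show "real_holomorphic_on \<phi> \<Omega>" by (simp add: real_holomorphic_on_def)
  have cont_Im: "continuous_on ?U (\<lambda>t. Im (F (of_real t)))"
    by (intro continuous_intros continuous_on_compose2[OF cont]) auto
  have nonneg: "0 \<le> Im (F (of_real x))" if "x \<in> ?U" for x
  proof (rule tendsto_lowerbound[OF _ _ at_within_upper_half_plane_nontrivial])
    have "(F \<longlongrightarrow> F (of_real x)) (at (of_real x) within \<Omega> \<union> {z. Im z > 0})"
      using cont that by (auto simp: continuous_on_def)
    then have "(F \<longlongrightarrow> F (of_real x)) (at (of_real x) within {z. Im z > 0})"
      by (rule tendsto_within_subset) auto
    then show "((\<lambda>z. Im (F z)) \<longlongrightarrow> Im (F (of_real x))) (at (of_real x) within {z. Im z > 0})"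
      by (rule tendsto_Im)
    show "\<forall>\<^sub>F z in at (of_real x) within {z. Im z > 0}. 0 \<le> Im (F z)"
      unfolding eventually_at_filter using F(2) pos by auto
  qed
  have "has_density_on \<sigma> (\<lambda>t. Im (F (of_real t)) / pi) ?U"
  proof (rule has_density_on_of_stieltjes_inversion[OF open_real_section[OF \<Omega>(1)] cont_Im nonneg])
    fix c d :: real assume cd: "c < d" "{c..d} \<subseteq> ?U"
    have sub: "cbox (Complex c 0) (Complex d 1) \<subseteq> \<Omega> \<union> {z. Im z > 0}"
    proof
      fix z assume "z \<in> cbox (Complex c 0) (Complex d 1)"
      then have z: "Re z \<in> {c..d}" "0 \<le> Im z" by (auto simp: in_cbox_complex_iff)
      show "z \<in> \<Omega> \<union> {z. Im z > 0}"
      proof (cases "Im z = 0")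
        case True
        then have "z = of_real (Re z)" by (simp add: complex_eq_iff)
        then show ?thesis using z cd by (metis UnI1 mem_Collect_eq subsetD)
      qed (use z in auto)
    qed
    have "continuous_on (cbox (Complex c 0) (Complex d 1)) (\<lambda>z. Im (F z) - b * Im z)"
      by (intro continuous_intros continuous_on_subset[OF cont sub])
    from stieltjes_inversion_continuous_boundary[OF _ this]
    show "(\<integral>\<^sup>+ x. ennreal (Im (F (of_real x))) * indicator {c..d} x \<partial>lborel)
      = (\<integral>\<^sup>+ t. ennreal (pi / 2 * (sgn (d - t) - sgn (c - t))) \<partial>\<sigma>)"
      using cd F(2) M by simp
  qed
  moreover have "Re (\<phi> (of_real t)) = Im (F (of_real t)) / pi" for t
    by (simp add: \<phi>_def complex_diff_cnj Re_divide power2_eq_square)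
  ultimately show "has_density_on \<sigma> (\<lambda>t. Re (\<phi> (of_real t))) ?U" by simp
qed

text \<open>
  The continuation is prescribed off the real axis by the jump relation, and on the axis as the
  limit from above.  Near each real point it coincides with the local continuation, so no
  compatibility between different real points has to be checked.
\<close>

lemma density_imp_continuation:
  assumes M: "\<And>z. Im z \<noteq> 0 \<Longrightarrow> M z = of_real a + of_real b * z + (\<integral>t. nevanlinna_kernel z t \<partial>\<sigma>)"
    and hol: "M holomorphic_on - \<real>"
    and \<Omega>: "open \<Omega>"
    and \<phi>: "real_holomorphic_on \<phi> \<Omega>"
    and dens: "has_density_on \<sigma> (\<lambda>t. Re (\<phi> (complex_of_real t))) {t. complex_of_real t \<in> \<Omega>}"
  shows "\<exists>F. F holomorphic_on (\<Omega> \<union> {z. Im z > 0}) \<and> (\<forall>z. Im z > 0 \<longrightarrow> F z = M z)"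
proof (intro exI conjI allI impI)
  define F where "F z = (if Im z > 0 then M z
      else if Im z < 0 then M z + 2 * of_real pi * \<i> * \<phi> z
      else Lim (at z within {z. Im z > 0}) M)" for z
  show "F z = M z" if "Im z > 0" for z using that by (simp add: F_def)
  have \<phi>_hol: "\<phi> holomorphic_on \<Omega>" using \<phi> by (simp add: real_holomorphic_on_def)
  have local: "\<exists>S H. open S \<and> w \<in> S \<and> H holomorphic_on S \<and> (\<forall>z\<in>S. H z = F z)"
    if w: "w \<in> \<Omega> \<union> {z. Im z > 0}" for w
  proof -
    consider "Im w > 0" | "Im w < 0" "w \<in> \<Omega>" | "Im w = 0" "w \<in> \<Omega>" using w by fastforce
    then show ?thesis
    proof cases
      case 1
      have "M holomorphic_on {z. Im z > 0}"
        using hol by (rule holomorphic_on_subset) (auto simp: complex_is_Real_iff)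
      then show ?thesis
        using 1 by (intro exI[of _ "{z. Im z > 0}"] exI[of _ M]) (auto simp: F_def open_halfspace_Im_gt)
    next
      case 2
      let ?S = "\<Omega> \<inter> {z. Im z < 0}"
      have "M holomorphic_on ?S"
        using hol by (rule holomorphic_on_subset) (auto simp: complex_is_Real_iff)
      moreover have "\<phi> holomorphic_on ?S" using \<phi>_hol by (rule holomorphic_on_subset) auto
      ultimately have "(\<lambda>z. M z + 2 * of_real pi * \<i> * \<phi> z) holomorphic_on ?S"
        by (intro holomorphic_intros)
      moreover have "open ?S" using \<Omega> open_halfspace_Im_lt by (intro open_Int)
      ultimately show ?thesis
        using 2 by (intro exI[of _ ?S] exI[of _ "\<lambda>z. M z + 2 * of_real pi * \<i> * \<phi> z"]) (auto simp: F_def)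
    next
      case 3
      then have w: "w = of_real (Re w)" by (simp add: complex_eq_iff)
      obtain r H where H: "0 < r" "H holomorphic_on ball (of_real (Re w)) r"
        "\<And>z. z \<in> ball (of_real (Re w)) r \<Longrightarrow> Im z > 0 \<Longrightarrow> (\<integral>t. nevanlinna_kernel z t \<partial>\<sigma>) = H z"
        "\<And>z. z \<in> ball (of_real (Re w)) r \<Longrightarrow> Im z < 0 \<Longrightarrow>
           (\<integral>t. nevanlinna_kernel z t \<partial>\<sigma>) = H z - 2 * of_real pi * \<i> * \<phi> z"
        using nevanlinna_integral_local_continuation[OF dens \<phi> \<Omega>, of "Re w"] 3 w by metis
      let ?B = "ball w r"
      define E where "E z = of_real a + of_real b * z + H z" for z
      have E: "E holomorphic_on ?B"
        unfolding E_def using H(2) w by (intro holomorphic_intros) auto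
      have upper: "M z = E z" if "z \<in> ?B" "Im z > 0" for z
        using that H(3)[of z] M[of z] w by (simp add: E_def)
      have "E z = F z" if z: "z \<in> ?B" for z
      proof -
        consider "Im z > 0" | "Im z < 0" | "Im z = 0" by linarith
        then show ?thesis
        proof cases
          case 1
          then show ?thesis using upper z by (simp add: F_def)
        next
          case 2
          then show ?thesis using z H(4)[of z] M[of z] w by (simp add: F_def E_def)
        next
          case 3
          have "(E \<longlongrightarrow> E z) (at z)"
            using holomorphic_on_imp_continuous_on[OF E] z
            by (simp add: continuous_on_eq_continuous_at isCont_def)
          then have "(E \<longlongrightarrow> E z) (at z within {z. Im z > 0})"
            by (rule tendsto_within_subset) auto
          moreover have "\<forall>\<^sub>F u in at z within {z. Im z > 0}. E u = M u"
            unfolding eventually_at_filter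
            using eventually_nhds_in_open[of ?B z] z upper by (auto elim!: eventually_mono)
          ultimately have "(M \<longlongrightarrow> E z) (at z within {z. Im z > 0})"
            by (rule Lim_transform_eventually)
          moreover have "at z within {z. Im z > 0} \<noteq> bot"
            using at_within_upper_half_plane_nontrivial[of "Re z"] 3
            by (metis complex_is_Real_iff of_real_Re)
          ultimately show ?thesis using 3 by (simp add: F_def tendsto_Lim)
        qed
      qed
      then show ?thesis using E H(1) by (intro exI[of _ ?B] exI[of _ E]) auto
    qed
  qed
  have "\<exists>D. (F has_field_derivative D) (at w)" if w: "w \<in> \<Omega> \<union> {z. Im z > 0}" for w
  proof -
    obtain S H where S: "open S" "w \<in> S" "H holomorphic_on S" "\<And>z. z \<in> S \<Longrightarrow> H z = F z"
      using local[OF w] by blast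
    have "(H has_field_derivative deriv H w) (at w)" using S by (intro holomorphic_derivI)
    then have "(F has_field_derivative deriv H w) (at w)"
      by (rule has_field_derivative_transform_within_open[OF _ S(1,2,4)])
    then show ?thesis by blast
  qed
  then show "F holomorphic_on (\<Omega> \<union> {z. Im z > 0})"
    using \<Omega> by (subst holomorphic_on_open) (auto simp: open_halfspace_Im_gt)
qed

end

theorem theorem2p1:
  fixes M :: "complex \<Rightarrow> complex" and a b :: real and \<sigma> :: "real measure"
    and \<Omega> :: "complex set"
  assumes "nevanlinna M"
    and "b \<ge> 0"
    and "sets \<sigma> = sets borel"
    and "(\<integral>\<^sup>+ t. ennreal (1 / (t\<^sup>2 + 1)) \<partial>\<sigma>) < \<infinity>"
    and "\<And>z. z \<notin> \<real> \<Longrightarrow>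
           M z = complex_of_real a + complex_of_real b * z +
             (\<integral>t. (1 / (complex_of_real t - z) - complex_of_real (t / (t\<^sup>2 + 1))) \<partial>\<sigma>)"
    and "is_domain \<Omega>"
    and "simply_connected \<Omega>"
    and "symmetric_wrt_reals \<Omega>"
  shows "(\<exists>F. F holomorphic_on (\<Omega> \<union> {z. Im z > 0}) \<and> (\<forall>z. Im z > 0 \<longrightarrow> F z = M z)) \<longleftrightarrow>
         (\<exists>\<phi>. real_holomorphic_on \<phi> \<Omega> \<and>
              has_density_on \<sigma> (\<lambda>t. Re (\<phi> (complex_of_real t))) {t. complex_of_real t \<in> \<Omega>})"
proof -
  interpret poisson_finite_measure \<sigma> using assms(3,4) by unfold_locales
  have M: "M z = of_real a + of_real b * z + (\<integral>t. nevanlinna_kernel z t \<partial>\<sigma>)" if "Im z \<noteq> 0" for z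
    using assms(5)[of z] that by (simp add: nevanlinna_kernel_def[abs_def] complex_is_Real_iff)
  have hol: "M holomorphic_on - \<real>" and pos: "\<And>z. Im z > 0 \<Longrightarrow> Im (M z) \<ge> 0"
    using assms(1) by (auto simp: nevanlinna_def)
  have \<Omega>: "open \<Omega>" using assms(6) by (simp add: is_domain_def)
  have M_upper: "M z = of_real a + of_real b * z + (\<integral>t. nevanlinna_kernel z t \<partial>\<sigma>)" if "Im z > 0" for z
    using M[of z] that by simp
  show ?thesis
  proof
    assume "\<exists>F. F holomorphic_on (\<Omega> \<union> {z. Im z > 0}) \<and> (\<forall>z. Im z > 0 \<longrightarrow> F z = M z)"
    then obtain F where F: "F holomorphic_on (\<Omega> \<union> {z. Im z > 0})" "\<And>z. Im z > 0 \<Longrightarrow> F z = M z"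
      by blast
    show "\<exists>\<phi>. real_holomorphic_on \<phi> \<Omega> \<and>
        has_density_on \<sigma> (\<lambda>t. Re (\<phi> (complex_of_real t))) {t. complex_of_real t \<in> \<Omega>}"
      by (rule continuation_imp_density[OF M_upper pos \<Omega> assms(8) F])
  next
    assume "\<exists>\<phi>. real_holomorphic_on \<phi> \<Omega> \<and>
        has_density_on \<sigma> (\<lambda>t. Re (\<phi> (complex_of_real t))) {t. complex_of_real t \<in> \<Omega>}"
    then obtain \<phi> where \<phi>: "real_holomorphic_on \<phi> \<Omega>"
      "has_density_on \<sigma> (\<lambda>t. Re (\<phi> (complex_of_real t))) {t. complex_of_real t \<in> \<Omega>}"
      by blast
    show "\<exists>F. F holomorphic_on (\<Omega> \<union> {z. Im z > 0}) \<and> (\<forall>z. Im z > 0 \<longrightarrow> F z = M z)"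
      by (rule density_imp_continuation[OF M hol \<Omega> \<phi>])
  qed
qed

end
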